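(* Let $N\ge2$ and let $X^\varepsilon_t$, $\varepsilon>0$, be a completely asymptotically regular family of continuous-time Markov chains on $S=\{1,\dots,N\}$ with transition rates $q_{ij}(\varepsilon)$. Then the reduced chain, i.e. the family of Markov chains on $\{S_1,\dots,S_n\}$ with transition rates $Q_{kl}(\varepsilon)$, $k\neq l$, is also completely asymptotically regular.
   Context: For each $\varepsilon>0$, $X^\varepsilon_t$, $t\ge0$, is a continuous-time Markov chain on the finite set $S=\{1,\dots,N\}$ with transition rates $q_{ij}(\varepsilon)$, $i\neq j$. A family of Markov chains on a finite state space with rates $q_{ij}(\varepsilon)$ is completely asymptotically regular if $q_{ij}(\varepsilon)>0$ for all $\varepsilon>0$, $i\ne j$, and for each integer $a>0$ and all $(i_1,\dots,i_a),(j_1,\dots,j_a),(k_1,\dots,k_a),(l_1,\dots,l_a)$ with $i_m\ne j_m$, $k_m\neq l_m$ for all $m$, the finite or infinite limit $\lim_{\varepsilon\downarrow0}\prod_{m=1}^a \frac{q_{i_mj_m}(\varepsilon)}{q_{k_ml_m}(\varepsilon)}\in[0,\infty]$ exists. (For a one-point state space the condition is vacuous.) The skeleton chain is the discrete-time Markov chain on $S$ with transition probabilities $P_{ij}=\lim_{\varepsilon\downarrow0} q_{ij}(\varepsilon)/\sum_{j'\ne i}q_{ij'}(\varepsilon)$ for $j\neq i$, and $P_{ii}=0$ (the limits exist when the family $X^\varepsilon_t$ is completely asymptotically regular). The state space decomposes uniquely into a disjoint union $S=S_1\cup\dots\cup S_n$, where each $S_k$ is either an ergodic class of the skeleton chain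 or a set consisting of a single transient state. For $1\le k\le n$, $Y^{k,\varepsilon}_t$ is the continuous-time Markov chain on $S_k$ with rates $q_{ij}(\varepsilon)$, $i,j\in S_k$, $i\neq j$, and $\mu^k(\cdot,\varepsilon)$ is its invariant probability measure. The reduced chain is the continuous-time Markov chain on $\{S_1,\dots,S_n\}$ with transition rates $Q_{kl}(\varepsilon)=\sum_{i\in S_k}\sum_{j\in S_l}\mu^k(i,\varepsilon)q_{ij}(\varepsilon)$ from $S_k$ to $S_l$, $k\ne l$. *)

theory Defs
  imports "HOL-Probability.Probability"
begin

text \<open>
  A continuous-time Markov chain on a finite state space \<open>S\<close> is represented by its transition
  rates \<open>r i j\<close> (\<open>i \<noteq> j\<close> in \<open>S\<close>), and a family of such chains by \<open>q \<epsilon> i j\<close> with \<open>\<epsilon> > 0\<close>.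
  Values on the diagonal, outside \<open>S\<close> and for \<open>\<epsilon> \<le> 0\<close> carry no meaning.
\<close>

definition completely_asymptotically_regular ::
  "'a set \<Rightarrow> (real \<Rightarrow> 'a \<Rightarrow> 'a \<Rightarrow> real) \<Rightarrow> bool" where
  "completely_asymptotically_regular S q \<longleftrightarrow>
     finite S \<and>
     (\<forall>\<epsilon>>0. \<forall>i\<in>S. \<forall>j\<in>S. i \<noteq> j \<longrightarrow> q \<epsilon> i j > 0) \<and>
     (\<forall>(a::nat)>0. \<forall>i j k l.
        (\<forall>m\<in>{1..a}. i m \<in> S \<and> j m \<in> S \<and> k m \<in> S \<and> l m \<in> S \<and> i m \<noteq> j m \<and> k m \<noteq> l m) \<longrightarrow>
        (\<exists>L\<in>{0..\<infinity>::ereal}.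
           ((\<lambda>\<epsilon>. ereal (\<Prod>m=1..a. q \<epsilon> (i m) (j m) / q \<epsilon> (k m) (l m))) \<longlongrightarrow> L) (at_right 0)))"


subsection \<open>The skeleton chain and its classes\<close>

definition skeleton :: "'a set \<Rightarrow> (real \<Rightarrow> 'a \<Rightarrow> 'a \<Rightarrow> real) \<Rightarrow> 'a \<Rightarrow> 'a \<Rightarrow> real" where
  "skeleton S q i j =
     (if i = j then 0 else Lim (at_right 0) (\<lambda>\<epsilon>. q \<epsilon> i j / (\<Sum>j'\<in>S - {i}. q \<epsilon> i j')))"

definition reachable :: "'a set \<Rightarrow> ('a \<Rightarrow> 'a \<Rightarrow> real) \<Rightarrow> 'a \<Rightarrow> 'a \<Rightarrow> bool" where
  "reachable S P = (\<lambda>i j. i \<in> S \<and> j \<in> S \<and> P i j > 0)\<^sup>*\<^sup>*"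

text \<open>
  Ergodic classes and transient states of a finite chain, in the sense of Kemeny and Snell:
  an ergodic class is a closed class of mutually reachable states (from each of its states,
  exactly the states of the class can be reached), and a state is transient if the chain can
  move from it to a state from which it cannot return.
\<close>

definition ergodic_class :: "'a set \<Rightarrow> ('a \<Rightarrow> 'a \<Rightarrow> real) \<Rightarrow> 'a set \<Rightarrow> bool" where
  "ergodic_class S P C \<longleftrightarrow>
     C \<noteq> {} \<and> C \<subseteq> S \<and> (\<forall>i\<in>C. \<forall>j\<in>S. reachable S P i j \<longleftrightarrow> j \<in> C)"

definition transient :: "'a set \<Rightarrow> ('a \<Rightarrow> 'a \<Rightarrow> real) \<Rightarrow> 'a \<Rightarrow> bool" where
  "transient S P i \<longleftrightarrow> i \<in> S \<and> (\<exists>j\<in>S. reachable S P i j \<and> \<not> reachable S P j i)"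

definition chain_classes :: "'a set \<Rightarrow> ('a \<Rightarrow> 'a \<Rightarrow> real) \<Rightarrow> 'a set set" where
  "chain_classes S P = {C. ergodic_class S P C} \<union> {{i} | i. transient S P i}"

lemma partition_on_chain_classes: "partition_on S (chain_classes S P)"
proof (rule partition_onI)
  have refl: "reachable S P i i" for i
    by (simp add: reachable_def)
  have trans: "reachable S P i k" if "reachable S P i j" "reachable S P j k" for i j k
    using that unfolding reachable_def by (rule rtranclp_trans)
  have not_both: "\<not> transient S P i" if "ergodic_class S P C" "i \<in> C" for C i
    using that unfolding ergodic_class_def transient_def by blast
  have cls: "ergodic_class S P {j\<in>S. reachable S P i j}" if "i \<in> S" "\<not> transient S P i" for i
    unfolding ergodic_class_def
  proof (intro conjI ballI)
    show "{j\<in>S. reachable S P i j} \<noteq> {}" using that refl by blast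
  next
    fix j k assume "j \<in> {j\<in>S. reachable S P i j}" "k \<in> S"
    then show "reachable S P j k \<longleftrightarrow> k \<in> {j\<in>S. reachable S P i j}"
      using that trans unfolding transient_def by blast
  qed auto
  show "\<Union> (chain_classes S P) = S"
  proof
    show "\<Union> (chain_classes S P) \<subseteq> S"
      unfolding chain_classes_def ergodic_class_def transient_def by auto
    show "S \<subseteq> \<Union> (chain_classes S P)"
      using cls refl unfolding chain_classes_def by fast
  qed
  show "{} \<notin> chain_classes S P"
    unfolding chain_classes_def ergodic_class_def by auto
  show "disjnt p p'" if "p \<in> chain_classes S P" "p' \<in> chain_classes S P" "p \<noteq> p'" for p p'
  proof -
    have "C = D" if "ergodic_class S P C" "ergodic_class S P D" "i \<in> C" "i \<in> D" for C D i
      using that unfolding ergodic_class_def by blast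
    then show ?thesis
      using that not_both unfolding chain_classes_def disjnt_def by blast
  qed
qed


subsection \<open>The reduced chain\<close>

text \<open>Invariance is stationarity for the generator of the chain on \<open>C\<close>: the equation \<open>\<mu> L = 0\<close>.\<close>

definition generator :: "'a set \<Rightarrow> ('a \<Rightarrow> 'a \<Rightarrow> real) \<Rightarrow> 'a \<Rightarrow> 'a \<Rightarrow> real" where
  "generator C r i j = (if i = j then - (\<Sum>k\<in>C - {i}. r i k) else r i j)"

definition invariant_measure :: "'a set \<Rightarrow> ('a \<Rightarrow> 'a \<Rightarrow> real) \<Rightarrow> 'a pmf \<Rightarrow> bool" where
  "invariant_measure C r \<mu> \<longleftrightarrow>
     set_pmf \<mu> \<subseteq> C \<and> (\<forall>j\<in>C. (\<Sum>i\<in>C. pmf \<mu> i * generator C r i j) = 0)"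

definition the_invariant_measure :: "'a set \<Rightarrow> ('a \<Rightarrow> 'a \<Rightarrow> real) \<Rightarrow> 'a pmf" where
  "the_invariant_measure C r = (THE \<mu>. invariant_measure C r \<mu>)"

definition reduced_rates :: "(real \<Rightarrow> 'a \<Rightarrow> 'a \<Rightarrow> real) \<Rightarrow> real \<Rightarrow> 'a set \<Rightarrow> 'a set \<Rightarrow> real" where
  "reduced_rates q \<epsilon> A B =
     (\<Sum>i\<in>A. \<Sum>j\<in>B. pmf (the_invariant_measure A (q \<epsilon>)) i * q \<epsilon> i j)"

end

theory Submission imports Defs begin

text \<open>
  Complete asymptotic regularity says that the rates can be compared at the level of monomials:
  two products of rates with equally many factors have a ratio with a limit in \<open>[0,\<infinity>]\<close>. The
  reduced rates are not monomials in the rates, but they are obtained from them by addition,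
  multiplication and division only, without any subtraction. In a sum of two positive terms
  that are asymptotic to constant multiples of monomials of equal degree, either one monomial
  dominates the other or the two are comparable; so the sum is again asymptotic to a positive
  multiple of one of the monomials (\<open>asymp_monomial_add\<close>). Hence every subtraction-free
  expression that is homogeneous of degree \<open>d\<close> in the rates is asymptotic to \<open>c M\<close> with \<open>c > 0\<close>
  and \<open>M\<close> a Laurent monomial of degree \<open>d\<close>, and if \<open>d = 0\<close> it has a limit in \<open>[0,\<infinity>]\<close>.
  Positivity of all terms is what makes this work: a difference of comparable monomials could
  cancel to something that regularity says nothing about.

  It remains to see that invariant measures are subtraction-free expressions of degree 0 in the
  rates. This is done by eliminating states. If \<open>z\<close> is removed and the rates are replaced by
  those of the chain watched outside \<open>z\<close>,
  \<open>r' i j = r i j + r i z * r z j / (\<Sum>k. r z k)\<close>,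
  then, up to scaling, invariant measures of the smaller chain are the restrictions of those of the
  larger one, and the mass at \<open>z\<close> is recovered from the balance of flow at \<open>z\<close>
  (\<open>stationary_insert_iff\<close>). Each step is free of subtraction and respects degrees, so
  induction on the number of states gives existence, uniqueness up to scaling, positivity and
  the asymptotic form of the invariant measure together (\<open>stationary_asymp_monomial\<close>).
  The reduced rates are then homogeneous of degree 1, and a product of ratios of them is
  homogeneous of degree 0. The argument applies to any partition of the state space into
  nonempty sets, in particular to the classes of the skeleton chain.
\<close>

section \<open>Functions asymptotic to Laurent monomials in the rates\<close>

definition laurent_monomial ::
  "'a set \<Rightarrow> (real \<Rightarrow> 'a \<Rightarrow> 'a \<Rightarrow> real) \<Rightarrow> int \<Rightarrow> (real \<Rightarrow> real) \<Rightarrow> bool" where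
  "laurent_monomial S q d M \<longleftrightarrow>
     (\<exists>xs ys. set xs \<subseteq> {(i, j). i \<in> S \<and> j \<in> S \<and> i \<noteq> j} \<and>
        set ys \<subseteq> {(i, j). i \<in> S \<and> j \<in> S \<and> i \<noteq> j} \<and>
        int (length xs) - int (length ys) = d \<and>
        M = (\<lambda>\<epsilon>. (\<Prod>(i, j)\<leftarrow>xs. q \<epsilon> i j) / (\<Prod>(i, j)\<leftarrow>ys. q \<epsilon> i j)))"

text \<open>
  Since the constant is nonzero, these functions can be divided by one another; since it is
  positive, no leading terms cancel when they are added.
\<close>

definition asymp_monomial ::
  "'a set \<Rightarrow> (real \<Rightarrow> 'a \<Rightarrow> 'a \<Rightarrow> real) \<Rightarrow> int \<Rightarrow> (real \<Rightarrow> real) \<Rightarrow> bool" where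
  "asymp_monomial S q d f \<longleftrightarrow>
     (\<exists>c>0. \<exists>M. laurent_monomial S q d M \<and> ((\<lambda>\<epsilon>. f \<epsilon> / M \<epsilon>) \<longlongrightarrow> c) (at_right 0))"

lemma eventually_at_right_0I:
  assumes "\<And>\<epsilon>::real. \<epsilon> > 0 \<Longrightarrow> P \<epsilon>"
  shows "eventually P (at_right 0)"
  by (auto simp: eventually_at_right_field intro!: exI[of _ 1] assms)

lemma asymp_monomial_cong:
  assumes "asymp_monomial S q d f" and "\<And>\<epsilon>. \<epsilon> > 0 \<Longrightarrow> f \<epsilon> = g \<epsilon>"
  shows "asymp_monomial S q d g"
proof -
  have "((\<lambda>\<epsilon>. f \<epsilon> / M \<epsilon>) \<longlongrightarrow> c) (at_right 0) \<Longrightarrow> ((\<lambda>\<epsilon>. g \<epsilon> / M \<epsilon>) \<longlongrightarrow> c) (at_right 0)" for M c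
    by (erule Lim_transform_eventually) (auto intro: eventually_at_right_0I simp: assms(2))
  then show ?thesis
    using assms(1) unfolding asymp_monomial_def by blast
qed

lemma laurent_monomialE:
  assumes "laurent_monomial S q d M"
  obtains xs ys where "set xs \<subseteq> {(i, j). i \<in> S \<and> j \<in> S \<and> i \<noteq> j}"
    "set ys \<subseteq> {(i, j). i \<in> S \<and> j \<in> S \<and> i \<noteq> j}" "int (length xs) - int (length ys) = d"
    "M = (\<lambda>\<epsilon>. (\<Prod>(i, j)\<leftarrow>xs. q \<epsilon> i j) / (\<Prod>(i, j)\<leftarrow>ys. q \<epsilon> i j))"
  using assms unfolding laurent_monomial_def by (elim exE conjE) (rule that)

lemma laurent_monomialI:
  assumes "set xs \<subseteq> {(i, j). i \<in> S \<and> j \<in> S \<and> i \<noteq> j}"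
    "set ys \<subseteq> {(i, j). i \<in> S \<and> j \<in> S \<and> i \<noteq> j}" "int (length xs) - int (length ys) = d"
    "\<And>\<epsilon>. M \<epsilon> = (\<Prod>(i, j)\<leftarrow>xs. q \<epsilon> i j) / (\<Prod>(i, j)\<leftarrow>ys. q \<epsilon> i j)"
  shows "laurent_monomial S q d M"
  unfolding laurent_monomial_def
  by (intro exI[of _ xs] exI[of _ ys] conjI ext assms)

lemma laurent_monomial_one: "laurent_monomial S q 0 (\<lambda>_. 1)"
  by (rule laurent_monomialI[of "[]" _ "[]"]) simp_all

lemma laurent_monomial_rate:
  assumes "i \<in> S" "j \<in> S" "i \<noteq> j"
  shows "laurent_monomial S q 1 (\<lambda>\<epsilon>. q \<epsilon> i j)"
  by (rule laurent_monomialI[of "[(i, j)]" _ "[]"]) (use assms in simp_all)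

lemma laurent_monomial_mult:
  assumes "laurent_monomial S q d M" "laurent_monomial S q e M'"
  shows "laurent_monomial S q (d + e) (\<lambda>\<epsilon>. M \<epsilon> * M' \<epsilon>)"
proof -
  from assms(1) obtain xs ys where 1: "set xs \<subseteq> {(i, j). i \<in> S \<and> j \<in> S \<and> i \<noteq> j}"
    "set ys \<subseteq> {(i, j). i \<in> S \<and> j \<in> S \<and> i \<noteq> j}" "int (length xs) - int (length ys) = d"
    "M = (\<lambda>\<epsilon>. (\<Prod>(i, j)\<leftarrow>xs. q \<epsilon> i j) / (\<Prod>(i, j)\<leftarrow>ys. q \<epsilon> i j))"
    by (rule laurent_monomialE)
  from assms(2) obtain xs' ys' where 2: "set xs' \<subseteq> {(i, j). i \<in> S \<and> j \<in> S \<and> i \<noteq> j}"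
    "set ys' \<subseteq> {(i, j). i \<in> S \<and> j \<in> S \<and> i \<noteq> j}" "int (length xs') - int (length ys') = e"
    "M' = (\<lambda>\<epsilon>. (\<Prod>(i, j)\<leftarrow>xs'. q \<epsilon> i j) / (\<Prod>(i, j)\<leftarrow>ys'. q \<epsilon> i j))"
    by (rule laurent_monomialE)
  show ?thesis
    by (rule laurent_monomialI[of "xs @ xs'" _ "ys @ ys'"]) (use 1 2 in simp_all)
qed

lemma laurent_monomial_inverse:
  assumes "laurent_monomial S q d M"
  shows "laurent_monomial S q (- d) (\<lambda>\<epsilon>. inverse (M \<epsilon>))"
proof -
  from assms obtain xs ys where "set xs \<subseteq> {(i, j). i \<in> S \<and> j \<in> S \<and> i \<noteq> j}"
    "set ys \<subseteq> {(i, j). i \<in> S \<and> j \<in> S \<and> i \<noteq> j}" "int (length xs) - int (length ys) = d"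
    "M = (\<lambda>\<epsilon>. (\<Prod>(i, j)\<leftarrow>xs. q \<epsilon> i j) / (\<Prod>(i, j)\<leftarrow>ys. q \<epsilon> i j))"
    by (rule laurent_monomialE)
  then show ?thesis
    by (intro laurent_monomialI[of ys _ xs]) simp_all
qed

lemma laurent_monomial_divide:
  assumes "laurent_monomial S q d M" "laurent_monomial S q e M'"
  shows "laurent_monomial S q (d - e) (\<lambda>\<epsilon>. M \<epsilon> / M' \<epsilon>)"
  using laurent_monomial_mult[OF assms(1) laurent_monomial_inverse[OF assms(2)]]
  by (simp add: divide_inverse)

locale regular_family =
  fixes S :: "'a set" and q :: "real \<Rightarrow> 'a \<Rightarrow> 'a \<Rightarrow> real"
  assumes regular: "completely_asymptotically_regular S q"
begin

lemma finite_states: "finite S"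
  using regular unfolding completely_asymptotically_regular_def by blast

lemma rate_pos: "\<epsilon> > 0 \<Longrightarrow> i \<in> S \<Longrightarrow> j \<in> S \<Longrightarrow> i \<noteq> j \<Longrightarrow> q \<epsilon> i j > 0"
  using regular unfolding completely_asymptotically_regular_def by blast

lemma laurent_monomial_pos:
  assumes "laurent_monomial S q d M" "\<epsilon> > 0"
  shows "M \<epsilon> > 0"
proof -
  have "(\<Prod>(i, j)\<leftarrow>xs. q \<epsilon> i j) > 0" if "set xs \<subseteq> {(i, j). i \<in> S \<and> j \<in> S \<and> i \<noteq> j}" for xs
    using that by (induction xs) (auto simp: rate_pos assms(2))
  then show ?thesis
    using assms(1) by (elim laurent_monomialE) simp
qed

text \<open>
  This is the hypothesis of complete asymptotic regularity, read for lists of transitions; the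
  empty list, which the hypothesis does not cover, gives the constant 1.
\<close>

lemma laurent_monomial_0_limit:
  assumes "laurent_monomial S q 0 M"
  obtains L where "L \<ge> 0" "((\<lambda>\<epsilon>. ereal (M \<epsilon>)) \<longlongrightarrow> L) (at_right 0)"
proof -
  from assms obtain xs ys where sub: "set xs \<subseteq> {(i, j). i \<in> S \<and> j \<in> S \<and> i \<noteq> j}"
      "set ys \<subseteq> {(i, j). i \<in> S \<and> j \<in> S \<and> i \<noteq> j}" and deg: "int (length xs) - int (length ys) = 0"
    and M: "M = (\<lambda>\<epsilon>. (\<Prod>(i, j)\<leftarrow>xs. q \<epsilon> i j) / (\<Prod>(i, j)\<leftarrow>ys. q \<epsilon> i j))"
    by (rule laurent_monomialE)
  have len: "length ys = length xs"
    using deg by simp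
  define a where "a = length xs"
  show ?thesis
  proof (cases "a = 0")
    case True
    then have "M = (\<lambda>_. 1)"
      using len by (auto simp: M a_def)
    then show ?thesis
      using that[of 1] by (simp add: one_ereal_def)
  next
    case False
    define src where "src zs m = fst (zs ! (m - 1))" for zs :: "('a \<times> 'a) list" and m :: nat
    define tgt where "tgt zs m = snd (zs ! (m - 1))" for zs :: "('a \<times> 'a) list" and m :: nat
    have "src zs m \<in> S \<and> tgt zs m \<in> S \<and> src zs m \<noteq> tgt zs m"
      if "m \<in> {1..a}" "zs \<in> {xs, ys}" for zs m
    proof -
      have "zs ! (m - 1) \<in> set zs"
        using that len by (auto simp: a_def)
      moreover have "set zs \<subseteq> {(i, j). i \<in> S \<and> j \<in> S \<and> i \<noteq> j}"
        using that(2) sub by auto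
      ultimately show ?thesis
        by (auto simp: src_def tgt_def split_beta)
    qed
    then have "\<exists>L\<in>{0..\<infinity>::ereal}. ((\<lambda>\<epsilon>. ereal (\<Prod>m=1..a.
        q \<epsilon> (src xs m) (tgt xs m) / q \<epsilon> (src ys m) (tgt ys m))) \<longlongrightarrow> L) (at_right 0)"
      using regular False unfolding completely_asymptotically_regular_def by auto
    moreover have "(\<Prod>m=1..a. q \<epsilon> (src xs m) (tgt xs m) / q \<epsilon> (src ys m) (tgt ys m)) = M \<epsilon>" for \<epsilon>
    proof -
      have "(\<Prod>m=1..a. q \<epsilon> (src zs m) (tgt zs m)) = (\<Prod>(i, j)\<leftarrow>zs. q \<epsilon> i j)"
        if "length zs = a" for zs
        by (simp add: prod.atLeast1_atMost_eq prod.list_conv_set_nth that src_def tgt_def split_beta lessThan_atLeast0)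
      then show ?thesis
        using len by (simp add: prod_dividef M a_def)
    qed
    ultimately show ?thesis
      using that by auto
  qed
qed

lemma asymp_monomial_one: "asymp_monomial S q 0 (\<lambda>_. 1)"
  unfolding asymp_monomial_def
  by (intro exI[of _ 1] conjI exI[of _ "\<lambda>_. 1"]) (auto simp: laurent_monomial_one)

lemma asymp_monomial_rate:
  assumes "i \<in> S" "j \<in> S" "i \<noteq> j"
  shows "asymp_monomial S q 1 (\<lambda>\<epsilon>. q \<epsilon> i j)"
proof -
  have "((\<lambda>\<epsilon>. q \<epsilon> i j / q \<epsilon> i j) \<longlongrightarrow> 1) (at_right 0)"
    by (rule tendsto_eventually, rule eventually_at_right_0I)
       (use rate_pos[OF _ assms] in \<open>simp add: less_imp_neq[symmetric]\<close>)
  then show ?thesis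
    unfolding asymp_monomial_def
    using laurent_monomial_rate[OF assms, of q] zero_less_one by blast
qed

lemma asymp_monomial_mult:
  assumes "asymp_monomial S q d f" "asymp_monomial S q e g"
  shows "asymp_monomial S q (d + e) (\<lambda>\<epsilon>. f \<epsilon> * g \<epsilon>)"
proof -
  obtain c M where M: "c > 0" "laurent_monomial S q d M" "((\<lambda>\<epsilon>. f \<epsilon> / M \<epsilon>) \<longlongrightarrow> c) (at_right 0)"
    using assms(1) unfolding asymp_monomial_def by blast
  obtain c' M' where M': "c' > 0" "laurent_monomial S q e M'"
      "((\<lambda>\<epsilon>. g \<epsilon> / M' \<epsilon>) \<longlongrightarrow> c') (at_right 0)"
    using assms(2) unfolding asymp_monomial_def by blast
  have "((\<lambda>\<epsilon>. f \<epsilon> * g \<epsilon> / (M \<epsilon> * M' \<epsilon>)) \<longlongrightarrow> c * c') (at_right 0)"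
    using tendsto_mult[OF M(3) M'(3)] by simp
  then show ?thesis
    unfolding asymp_monomial_def
    using laurent_monomial_mult[OF M(2) M'(2)] mult_pos_pos[OF M(1) M'(1)] by blast
qed

lemma asymp_monomial_divide:
  assumes "asymp_monomial S q d f" "asymp_monomial S q e g"
  shows "asymp_monomial S q (d - e) (\<lambda>\<epsilon>. f \<epsilon> / g \<epsilon>)"
proof -
  obtain c M where M: "c > 0" "laurent_monomial S q d M" "((\<lambda>\<epsilon>. f \<epsilon> / M \<epsilon>) \<longlongrightarrow> c) (at_right 0)"
    using assms(1) unfolding asymp_monomial_def by blast
  obtain c' M' where M': "c' > 0" "laurent_monomial S q e M'"
      "((\<lambda>\<epsilon>. g \<epsilon> / M' \<epsilon>) \<longlongrightarrow> c') (at_right 0)"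
    using assms(2) unfolding asymp_monomial_def by blast
  have "((\<lambda>\<epsilon>. (f \<epsilon> / g \<epsilon>) / (M \<epsilon> / M' \<epsilon>)) \<longlongrightarrow> c / c') (at_right 0)"
    using tendsto_divide[OF M(3) M'(3)] M'(1) by (simp add: field_simps)
  then show ?thesis
    unfolding asymp_monomial_def
    using laurent_monomial_divide[OF M(2) M'(2)] divide_pos_pos[OF M(1) M'(1)] by blast
qed

text \<open>
  The dominant one of two monomials of equal degree can be singled out because their ratio has
  a limit in \<open>[0,\<infinity>]\<close>.
\<close>

lemma asymp_monomial_add:
  assumes "asymp_monomial S q d f" "asymp_monomial S q d g"
  shows "asymp_monomial S q d (\<lambda>\<epsilon>. f \<epsilon> + g \<epsilon>)"
proof -
  obtain c M where M: "c > 0" "laurent_monomial S q d M" "((\<lambda>\<epsilon>. f \<epsilon> / M \<epsilon>) \<longlongrightarrow> c) (at_right 0)"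
    using assms(1) unfolding asymp_monomial_def by blast
  obtain c' M' where M': "c' > 0" "laurent_monomial S q d M'"
      "((\<lambda>\<epsilon>. g \<epsilon> / M' \<epsilon>) \<longlongrightarrow> c') (at_right 0)"
    using assms(2) unfolding asymp_monomial_def by blast
  have nz: "M \<epsilon> \<noteq> 0" "M' \<epsilon> \<noteq> 0" if "\<epsilon> > 0" for \<epsilon>
    using laurent_monomial_pos[OF M(2) that] laurent_monomial_pos[OF M'(2) that] by auto
  obtain L where L: "L \<ge> 0" "((\<lambda>\<epsilon>. ereal (M \<epsilon> / M' \<epsilon>)) \<longlongrightarrow> L) (at_right 0)"
    using laurent_monomial_0_limit[of "\<lambda>\<epsilon>. M \<epsilon> / M' \<epsilon>"] laurent_monomial_divide[OF M(2) M'(2)]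
    by auto
  show ?thesis
  proof (cases L)
    case (real l)
    then have lim: "((\<lambda>\<epsilon>. M \<epsilon> / M' \<epsilon>) \<longlongrightarrow> l) (at_right 0)"
      using L(2) by simp
    have "((\<lambda>\<epsilon>. (f \<epsilon> + g \<epsilon>) / M' \<epsilon>) \<longlongrightarrow> c * l + c') (at_right 0)"
      by (rule Lim_transform_eventually[OF tendsto_add[OF tendsto_mult[OF M(3) lim] M'(3)]])
         (auto intro!: eventually_at_right_0I simp: nz field_simps)
    moreover have "c * l + c' > 0"
      using L(1) real M(1) M'(1) by (simp add: add_nonneg_pos)
    ultimately show ?thesis
      unfolding asymp_monomial_def using M'(2) by blast
  next
    case PInf
    then have "filterlim (\<lambda>\<epsilon>. M \<epsilon> / M' \<epsilon>) at_top (at_right 0)"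
      using L(2) by (simp add: tendsto_PInfty_eq_at_top)
    then have lim: "((\<lambda>\<epsilon>. M' \<epsilon> / M \<epsilon>) \<longlongrightarrow> 0) (at_right 0)"
      using tendsto_inverse_0_at_top by fastforce
    have "((\<lambda>\<epsilon>. (f \<epsilon> + g \<epsilon>) / M \<epsilon>) \<longlongrightarrow> c + c' * 0) (at_right 0)"
      by (rule Lim_transform_eventually[OF tendsto_add[OF M(3) tendsto_mult[OF M'(3) lim]]])
         (auto intro!: eventually_at_right_0I simp: nz field_simps)
    then show ?thesis
      unfolding asymp_monomial_def using M(1,2) by auto
  next
    case MInf
    then show ?thesis using L(1) by simp
  qed
qed

lemma asymp_monomial_sum:
  assumes "finite A" "A \<noteq> {}" "\<And>x. x \<in> A \<Longrightarrow> asymp_monomial S q d (\<lambda>\<epsilon>. f \<epsilon> x)"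
  shows "asymp_monomial S q d (\<lambda>\<epsilon>. \<Sum>x\<in>A. f \<epsilon> x)"
  using assms by (induction A rule: finite_ne_induct) (auto intro: asymp_monomial_add)

lemma asymp_monomial_prod_0:
  assumes "finite A" "\<And>x. x \<in> A \<Longrightarrow> asymp_monomial S q 0 (\<lambda>\<epsilon>. f \<epsilon> x)"
  shows "asymp_monomial S q 0 (\<lambda>\<epsilon>. \<Prod>x\<in>A. f \<epsilon> x)"
  using assms
proof (induction A rule: finite_induct)
  case empty
  then show ?case by (simp add: asymp_monomial_one)
next
  case (insert x A)
  then show ?case
    using asymp_monomial_mult[of 0 "\<lambda>\<epsilon>. f \<epsilon> x" 0 "\<lambda>\<epsilon>. \<Prod>x\<in>A. f \<epsilon> x"] by simp
qed

lemma asymp_monomial_0_limit: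
  assumes "asymp_monomial S q 0 f"
  obtains L where "L \<ge> 0" "((\<lambda>\<epsilon>. ereal (f \<epsilon>)) \<longlongrightarrow> L) (at_right 0)"
proof -
  obtain c M where M: "c > 0" "laurent_monomial S q 0 M" "((\<lambda>\<epsilon>. f \<epsilon> / M \<epsilon>) \<longlongrightarrow> c) (at_right 0)"
    using assms unfolding asymp_monomial_def by blast
  obtain L where L: "L \<ge> 0" "((\<lambda>\<epsilon>. ereal (M \<epsilon>)) \<longlongrightarrow> L) (at_right 0)"
    using laurent_monomial_0_limit[OF M(2)] .
  \<comment> \<open>The product of the limits is not of the form \<open>0 * \<infinity>\<close> since \<open>c\<close> is positive and finite.\<close>
  have "((\<lambda>\<epsilon>. ereal (f \<epsilon> / M \<epsilon>) * ereal (M \<epsilon>)) \<longlongrightarrow> ereal c * L) (at_right 0)"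
    by (rule tendsto_mult_ereal) (use M L in auto)
  then have "((\<lambda>\<epsilon>. ereal (f \<epsilon>)) \<longlongrightarrow> ereal c * L) (at_right 0)"
    by (rule Lim_transform_eventually)
       (auto intro!: eventually_at_right_0I dest: laurent_monomial_pos[OF M(2)])
  then show ?thesis
    using that[of "ereal c * L"] L(1) M(1) by simp
qed

end


section \<open>Invariant measures by elimination of states\<close>

text \<open>
  Both sums include the diagonal term \<open>x j * r j j\<close>, which cancels. So the diagonal of \<open>r\<close> is
  arbitrary, and the rates produced by an elimination need no correction there.
\<close>

definition stationary :: "'a set \<Rightarrow> ('a \<Rightarrow> 'a \<Rightarrow> real) \<Rightarrow> ('a \<Rightarrow> real) \<Rightarrow> bool" where
  "stationary C r x \<longleftrightarrow> (\<forall>j\<in>C. (\<Sum>i\<in>C. x i * r i j) = x j * (\<Sum>k\<in>C. r j k))"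

lemma sum_generator:
  assumes "finite C" "j \<in> C"
  shows "(\<Sum>i\<in>C. x i * generator C r i j) = (\<Sum>i\<in>C. x i * r i j) - x j * (\<Sum>k\<in>C. r j k)"
proof -
  have "(\<Sum>i\<in>C - {j}. x i * generator C r i j) = (\<Sum>i\<in>C - {j}. x i * r i j)"
    by (rule sum.cong) (auto simp: generator_def)
  then show ?thesis
    by (simp add: sum.remove[OF assms] generator_def algebra_simps)
qed

lemma invariant_measure_iff_stationary:
  assumes "finite C"
  shows "invariant_measure C r \<mu> \<longleftrightarrow> set_pmf \<mu> \<subseteq> C \<and> stationary C r (pmf \<mu>)"
  using assms unfolding invariant_measure_def stationary_def by (simp add: sum_generator)

text \<open>
  The rates of the chain observed only while it is outside \<open>z\<close>: on entering \<open>z\<close> it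
  next moves to \<open>j\<close> with probability \<open>r z j / (\<Sum>k\<in>C. r z k)\<close>.
\<close>

definition eliminate :: "'a \<Rightarrow> 'a set \<Rightarrow> ('a \<Rightarrow> 'a \<Rightarrow> real) \<Rightarrow> 'a \<Rightarrow> 'a \<Rightarrow> real" where
  "eliminate z C r i j = r i j + r i z * r z j / (\<Sum>k\<in>C. r z k)"

text \<open>
  Balance at \<open>z\<close> expresses \<open>x z\<close> through the other masses; substituting this into the balance
  equation at \<open>j \<noteq> z\<close> gives precisely the balance equation at \<open>j\<close> for the eliminated rates.
\<close>

lemma stationary_insert_iff:
  assumes "finite C" "z \<notin> C" and pos: "(\<Sum>k\<in>C. r z k) > 0"
  shows "stationary (insert z C) r x \<longleftrightarrow>
    stationary C (eliminate z C r) x \<and> x z = (\<Sum>i\<in>C. x i * r i z) / (\<Sum>k\<in>C. r z k)"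
proof -
  define R where "R = (\<Sum>k\<in>C. r z k)"
  have R: "R > 0" using pos by (simp add: R_def)
  have at_z: "(\<Sum>i\<in>insert z C. x i * r i z) = x z * (\<Sum>k\<in>insert z C. r z k) \<longleftrightarrow>
      x z = (\<Sum>i\<in>C. x i * r i z) / R"
    using assms(1,2) R by (auto simp: R_def[symmetric] field_simps)
  have at_j: "(\<Sum>i\<in>insert z C. x i * r i j) = x j * (\<Sum>k\<in>insert z C. r j k) \<longleftrightarrow>
      (\<Sum>i\<in>C. x i * eliminate z C r i j) = x j * (\<Sum>k\<in>C. eliminate z C r j k)"
    if xz: "x z = (\<Sum>i\<in>C. x i * r i z) / R" for j
  proof -
    have "(\<Sum>i\<in>C. x i * eliminate z C r i j) =
        (\<Sum>i\<in>C. x i * r i j) + (\<Sum>i\<in>C. x i * r i z) / R * r z j"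
      by (simp add: eliminate_def R_def[symmetric] sum.distrib distrib_left sum_divide_distrib
          sum_distrib_right mult.assoc)
    moreover have "(\<Sum>k\<in>C. eliminate z C r j k) = (\<Sum>k\<in>C. r j k) + r j z * R / R"
      by (simp add: eliminate_def R_def sum.distrib sum_divide_distrib sum_distrib_left)
    ultimately show ?thesis
      using assms(1,2) R xz by (simp add: algebra_simps)
  qed
  show ?thesis
    unfolding stationary_def R_def[symmetric]
    using at_z at_j by (auto simp only: ball_simps)
qed

context regular_family
begin

text \<open>
  The rates \<open>r\<close> are allowed to be more general than \<open>q\<close> because elimination leaves the original
  rates; what it preserves is that they are positive and of degree 1. Uniqueness up to scaling
  is part of the induction, since the two solution spaces are identified by an elimination.
\<close>

lemma stationary_asymp_monomial:
  assumes "finite C" "C \<noteq> {}"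
    and "\<And>i j. i \<in> C \<Longrightarrow> j \<in> C \<Longrightarrow> i \<noteq> j \<Longrightarrow> asymp_monomial S q 1 (\<lambda>\<epsilon>. r \<epsilon> i j)"
    and "\<And>i j \<epsilon>. i \<in> C \<Longrightarrow> j \<in> C \<Longrightarrow> i \<noteq> j \<Longrightarrow> \<epsilon> > 0 \<Longrightarrow> r \<epsilon> i j > 0"
  shows "\<exists>w. (\<forall>i\<in>C. asymp_monomial S q 0 (\<lambda>\<epsilon>. w \<epsilon> i) \<and> (\<forall>\<epsilon>>0. w \<epsilon> i > 0)) \<and>
    (\<forall>\<epsilon>>0. \<forall>x. stationary C (r \<epsilon>) x \<longleftrightarrow> (\<exists>c. \<forall>i\<in>C. x i = c * w \<epsilon> i))"
  using assms
proof (induction C arbitrary: r rule: finite_ne_induct)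
  case (singleton a)
  show ?case
    by (intro exI[of _ "\<lambda>_ _. 1"]) (auto simp: stationary_def asymp_monomial_one)
next
  case (insert z C)
  define r' where "r' \<epsilon> = eliminate z C (r \<epsilon>)" for \<epsilon>
  define R where "R \<epsilon> = (\<Sum>k\<in>C. r \<epsilon> z k)" for \<epsilon>
  have asymp: "asymp_monomial S q 1 (\<lambda>\<epsilon>. r \<epsilon> i j)"
    if "i \<in> insert z C" "j \<in> insert z C" "i \<noteq> j" for i j
    using insert.prems(1) that .
  have pos: "r \<epsilon> i j > 0" if "i \<in> insert z C" "j \<in> insert z C" "i \<noteq> j" "\<epsilon> > 0" for i j \<epsilon>
    using insert.prems(2) that .
  have R_asymp: "asymp_monomial S q 1 R"
    unfolding R_def using insert.hyps by (intro asymp_monomial_sum asymp) auto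
  have R_pos: "R \<epsilon> > 0" if "\<epsilon> > 0" for \<epsilon>
    unfolding R_def using insert.hyps that by (intro sum_pos pos) auto
  have "asymp_monomial S q 1 (\<lambda>\<epsilon>. r' \<epsilon> i j)" if "i \<in> C" "j \<in> C" "i \<noteq> j" for i j
  proof -
    have "asymp_monomial S q (1 + 1 - 1) (\<lambda>\<epsilon>. r \<epsilon> i z * r \<epsilon> z j / R \<epsilon>)"
      using that insert.hyps
      by (intro asymp_monomial_divide asymp_monomial_mult asymp R_asymp) auto
    then show ?thesis
      unfolding r'_def eliminate_def R_def[symmetric]
      using that by (intro asymp_monomial_add asymp) auto
  qed
  moreover have "r' \<epsilon> i j > 0" if "i \<in> C" "j \<in> C" "i \<noteq> j" "\<epsilon> > 0" for i j \<epsilon>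
    unfolding r'_def eliminate_def R_def[symmetric]
    using that insert.hyps R_pos
    by (intro add_pos_pos divide_pos_pos mult_pos_pos pos) auto
  ultimately have "\<exists>w. (\<forall>i\<in>C. asymp_monomial S q 0 (\<lambda>\<epsilon>. w \<epsilon> i) \<and> (\<forall>\<epsilon>>0. w \<epsilon> i > 0)) \<and>
      (\<forall>\<epsilon>>0. \<forall>x. stationary C (r' \<epsilon>) x \<longleftrightarrow> (\<exists>c. \<forall>i\<in>C. x i = c * w \<epsilon> i))"
    by (rule insert.IH)
  then obtain w where
    w: "\<And>i. i \<in> C \<Longrightarrow> asymp_monomial S q 0 (\<lambda>\<epsilon>. w \<epsilon> i)" "\<And>i \<epsilon>. i \<in> C \<Longrightarrow> \<epsilon> > 0 \<Longrightarrow> w \<epsilon> i > 0"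
    and w_iff: "\<And>\<epsilon> x. \<epsilon> > 0 \<Longrightarrow> stationary C (r' \<epsilon>) x \<longleftrightarrow> (\<exists>c. \<forall>i\<in>C. x i = c * w \<epsilon> i)"
    by (elim exE conjE) (rule that, simp_all)
  define wz where "wz \<epsilon> = (\<Sum>i\<in>C. w \<epsilon> i * r \<epsilon> i z) / R \<epsilon>" for \<epsilon>
  define v where "v \<epsilon> = (w \<epsilon>)(z := wz \<epsilon>)" for \<epsilon>
  have "asymp_monomial S q 1 (\<lambda>\<epsilon>. w \<epsilon> i * r \<epsilon> i z)" if "i \<in> C" for i
    using asymp_monomial_mult[OF w(1) asymp, of i i z] that insert.hyps by auto
  then have "asymp_monomial S q 1 (\<lambda>\<epsilon>. \<Sum>i\<in>C. w \<epsilon> i * r \<epsilon> i z)"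
    using insert.hyps by (intro asymp_monomial_sum) auto
  from asymp_monomial_divide[OF this R_asymp]
  have wz_asymp: "asymp_monomial S q 0 wz"
    by (simp add: wz_def[abs_def])
  have wz_pos: "wz \<epsilon> > 0" if "\<epsilon> > 0" for \<epsilon>
    unfolding wz_def
    using insert.hyps that by (intro divide_pos_pos sum_pos mult_pos_pos w pos R_pos) auto
  have v_iff: "stationary (insert z C) (r \<epsilon>) x \<longleftrightarrow> (\<exists>c. \<forall>i\<in>insert z C. x i = c * v \<epsilon> i)"
    if \<epsilon>: "\<epsilon> > 0" for \<epsilon> x
  proof -
    have x_z: "(\<Sum>i\<in>C. x i * r \<epsilon> i z) / R \<epsilon> = c * wz \<epsilon>" if "\<forall>i\<in>C. x i = c * w \<epsilon> i" for c
      using that by (simp add: wz_def sum_distrib_left mult.assoc)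
    have "(\<forall>i\<in>C. x i = c * w \<epsilon> i) \<and> x z = (\<Sum>i\<in>C. x i * r \<epsilon> i z) / R \<epsilon> \<longleftrightarrow>
        (\<forall>i\<in>C. x i = c * w \<epsilon> i) \<and> x z = c * wz \<epsilon>" for c
      by (intro conj_cong refl) (simp only: x_z)
    then have "(\<exists>c. \<forall>i\<in>C. x i = c * w \<epsilon> i) \<and> x z = (\<Sum>i\<in>C. x i * r \<epsilon> i z) / R \<epsilon> \<longleftrightarrow>
        (\<exists>c. (\<forall>i\<in>C. x i = c * w \<epsilon> i) \<and> x z = c * wz \<epsilon>)"
      by (simp only: ex_simps(1)[symmetric])
    moreover have "(\<forall>i\<in>insert z C. x i = c * v \<epsilon> i) \<longleftrightarrow>
        (\<forall>i\<in>C. x i = c * w \<epsilon> i) \<and> x z = c * wz \<epsilon>" for c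
      using insert.hyps by (auto simp: v_def)
    ultimately show ?thesis
      using stationary_insert_iff[of C z "r \<epsilon>" x] insert.hyps R_pos[OF \<epsilon>] w_iff[OF \<epsilon>, of x]
      by (simp add: R_def r'_def)
  qed
  have "asymp_monomial S q 0 (\<lambda>\<epsilon>. v \<epsilon> i) \<and> (\<forall>\<epsilon>>0. v \<epsilon> i > 0)" if "i \<in> insert z C" for i
    using that w wz_asymp wz_pos by (cases "i = z") (auto simp: v_def)
  with v_iff show ?case
    by (intro exI[of _ v]) blast
qed

text \<open>
  Normalizing the solution of the balance equations to total mass 1 keeps it of degree 0.
\<close>

lemma invariant_measure_asymp_monomial:
  assumes "C \<subseteq> S" "C \<noteq> {}" "i \<in> C"
  shows "asymp_monomial S q 0 (\<lambda>\<epsilon>. pmf (the_invariant_measure C (q \<epsilon>)) i)"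
    and "\<And>\<epsilon>. \<epsilon> > 0 \<Longrightarrow> pmf (the_invariant_measure C (q \<epsilon>)) i > 0"
proof -
  have fin: "finite C"
    using assms(1) finite_states finite_subset by blast
  have "\<exists>w. (\<forall>i\<in>C. asymp_monomial S q 0 (\<lambda>\<epsilon>. w \<epsilon> i) \<and> (\<forall>\<epsilon>>0. w \<epsilon> i > 0)) \<and>
      (\<forall>\<epsilon>>0. \<forall>x. stationary C (q \<epsilon>) x \<longleftrightarrow> (\<exists>c. \<forall>i\<in>C. x i = c * w \<epsilon> i))"
    using subsetD[OF assms(1)]
    by (intro stationary_asymp_monomial fin assms(2) asymp_monomial_rate rate_pos)
  then obtain w where w: "\<And>i. i \<in> C \<Longrightarrow> asymp_monomial S q 0 (\<lambda>\<epsilon>. w \<epsilon> i)"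
      "\<And>i \<epsilon>. i \<in> C \<Longrightarrow> \<epsilon> > 0 \<Longrightarrow> w \<epsilon> i > 0"
    and w_iff: "\<And>\<epsilon> x. \<epsilon> > 0 \<Longrightarrow> stationary C (q \<epsilon>) x \<longleftrightarrow> (\<exists>c. \<forall>i\<in>C. x i = c * w \<epsilon> i)"
    by (elim exE conjE) (rule that, simp_all)
  define W where "W \<epsilon> = (\<Sum>i\<in>C. w \<epsilon> i)" for \<epsilon>
  have W_pos: "W \<epsilon> > 0" if "\<epsilon> > 0" for \<epsilon>
    unfolding W_def using that fin assms(2) by (intro sum_pos w)
  have eq: "pmf (the_invariant_measure C (q \<epsilon>)) i = w \<epsilon> i / W \<epsilon>" if \<epsilon>: "\<epsilon> > 0" and "i \<in> C" for \<epsilon> i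
  proof -
    define p where "p i = (if i \<in> C then w \<epsilon> i / W \<epsilon> else 0)" for i
    have p_nonneg: "p i \<ge> 0" for i
      using w(2) W_pos \<epsilon> by (simp add: p_def less_imp_le)
    have "(\<integral>\<^sup>+ i. ennreal (p i) \<partial>count_space UNIV) = (\<Sum>i\<in>C. ennreal (p i))"
      by (rule nn_integral_count_space'[OF fin]) (auto simp: p_def)
    also have "\<dots> = ennreal (\<Sum>i\<in>C. p i)"
      using p_nonneg by simp
    also have "(\<Sum>i\<in>C. p i) = 1"
      using W_pos[OF \<epsilon>] by (simp add: p_def W_def sum_divide_distrib[symmetric])
    finally have mass: "(\<integral>\<^sup>+ i. ennreal (p i) \<partial>count_space UNIV) = 1"
      by simp
    define \<mu> where "\<mu> = embed_pmf p"
    have pmf_\<mu>: "pmf \<mu> i = p i" for i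
      unfolding \<mu>_def by (rule pmf_embed_pmf[OF p_nonneg mass])
    have "stationary C (q \<epsilon>) (pmf \<mu>)"
      unfolding w_iff[OF \<epsilon>] by (rule exI[of _ "1 / W \<epsilon>"]) (simp add: pmf_\<mu> p_def)
    moreover have "set_pmf \<mu> \<subseteq> C"
      by (auto simp: set_pmf_iff pmf_\<mu> p_def split: if_splits)
    ultimately have inv: "invariant_measure C (q \<epsilon>) \<mu>"
      by (simp add: invariant_measure_iff_stationary[OF fin])
    have "\<nu> = \<mu>" if \<nu>: "invariant_measure C (q \<epsilon>) \<nu>" for \<nu>
    proof -
      have sub: "set_pmf \<nu> \<subseteq> C" and "stationary C (q \<epsilon>) (pmf \<nu>)"
        using \<nu> by (simp_all add: invariant_measure_iff_stationary[OF fin])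
      then obtain c where c: "\<And>i. i \<in> C \<Longrightarrow> pmf \<nu> i = c * w \<epsilon> i"
        using w_iff[OF \<epsilon>] by blast
      have "c * W \<epsilon> = (\<Sum>i\<in>C. pmf \<nu> i)"
        by (simp add: W_def sum_distrib_left c)
      also have "\<dots> = 1"
        using sum_pmf_eq_1[OF fin sub] .
      finally have "c = 1 / W \<epsilon>"
        using W_pos[OF \<epsilon>] by (simp add: field_simps)
      then have "pmf \<nu> i = pmf \<mu> i" for i
        using c sub by (cases "i \<in> C") (auto simp: pmf_\<mu> p_def pmf_eq_0_set_pmf)
      then show ?thesis
        by (rule pmf_eqI)
    qed
    with inv have "the_invariant_measure C (q \<epsilon>) = \<mu>"
      unfolding the_invariant_measure_def by (rule the_equality)
    then show ?thesis
      using \<open>i \<in> C\<close> by (simp add: pmf_\<mu> p_def)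
  qed
  have "asymp_monomial S q 0 W"
    unfolding W_def using fin assms(2) by (intro asymp_monomial_sum w)
  from asymp_monomial_divide[OF w(1)[OF assms(3)] this]
  have "asymp_monomial S q 0 (\<lambda>\<epsilon>. w \<epsilon> i / W \<epsilon>)"
    by simp
  then show "asymp_monomial S q 0 (\<lambda>\<epsilon>. pmf (the_invariant_measure C (q \<epsilon>)) i)"
    by (rule asymp_monomial_cong) (simp add: eq assms(3))
  show "pmf (the_invariant_measure C (q \<epsilon>)) i > 0" if "\<epsilon> > 0" for \<epsilon>
    using that assms(3) by (simp add: eq w W_pos)
qed


section \<open>The reduced chain\<close>

lemma reduced_rates_asymp_monomial:
  assumes "A \<subseteq> S" "A \<noteq> {}" "B \<subseteq> S" "B \<noteq> {}" "A \<inter> B = {}"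
  shows "asymp_monomial S q 1 (\<lambda>\<epsilon>. reduced_rates q \<epsilon> A B)"
    and "\<And>\<epsilon>. \<epsilon> > 0 \<Longrightarrow> reduced_rates q \<epsilon> A B > 0"
proof -
  have fin: "finite A" "finite B"
    using assms finite_states finite_subset by blast+
  have off_diag: "i \<in> S" "j \<in> S" "i \<noteq> j" if "i \<in> A" "j \<in> B" for i j
    using that assms by auto
  have "asymp_monomial S q (0 + 1) (\<lambda>\<epsilon>. pmf (the_invariant_measure A (q \<epsilon>)) i * q \<epsilon> i j)"
    if "i \<in> A" "j \<in> B" for i j
    using that off_diag[OF that] assms(1,2)
    by (intro asymp_monomial_mult invariant_measure_asymp_monomial asymp_monomial_rate)
  then show "asymp_monomial S q 1 (\<lambda>\<epsilon>. reduced_rates q \<epsilon> A B)"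
    unfolding reduced_rates_def using fin assms(2,4) by (intro asymp_monomial_sum) auto
  show "reduced_rates q \<epsilon> A B > 0" if "\<epsilon> > 0" for \<epsilon>
    unfolding reduced_rates_def using fin assms that off_diag
    by (intro sum_pos mult_pos_pos invariant_measure_asymp_monomial rate_pos) auto
qed

theorem completely_asymptotically_regular_reduced_rates:
  assumes "partition_on S \<P>"
  shows "completely_asymptotically_regular \<P> (reduced_rates q)"
  unfolding completely_asymptotically_regular_def
proof (intro conjI allI impI ballI)
  show "finite \<P>"
    using finite_elements[OF finite_states assms] .
next
  have cls: "A \<subseteq> S" "A \<noteq> {}" if "A \<in> \<P>" for A
    using assms that by (auto simp: partition_on_def)
  have disj: "A \<inter> B = {}" if "A \<in> \<P>" "B \<in> \<P>" "A \<noteq> B" for A B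
    using assms that by (auto simp: partition_on_def disjoint_def)
  show "reduced_rates q \<epsilon> A B > 0" if "\<epsilon> > 0" "A \<in> \<P>" "B \<in> \<P>" "A \<noteq> B" for \<epsilon> A B
    using that cls disj by (intro reduced_rates_asymp_monomial)
  have rate: "asymp_monomial S q 1 (\<lambda>\<epsilon>. reduced_rates q \<epsilon> A B)"
    if "A \<in> \<P>" "B \<in> \<P>" "A \<noteq> B" for A B
    using that cls disj by (intro reduced_rates_asymp_monomial)
  fix a :: nat and i j k l :: "nat \<Rightarrow> 'a set"
  assume *: "\<forall>m\<in>{1..a}. i m \<in> \<P> \<and> j m \<in> \<P> \<and> k m \<in> \<P> \<and> l m \<in> \<P> \<and> i m \<noteq> j m \<and> k m \<noteq> l m"
  have "asymp_monomial S q (1 - 1)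
      (\<lambda>\<epsilon>. reduced_rates q \<epsilon> (i m) (j m) / reduced_rates q \<epsilon> (k m) (l m))" if "m \<in> {1..a}" for m
    using bspec[OF * that] by (intro asymp_monomial_divide rate) simp_all
  then have "asymp_monomial S q 0
      (\<lambda>\<epsilon>. \<Prod>m=1..a. reduced_rates q \<epsilon> (i m) (j m) / reduced_rates q \<epsilon> (k m) (l m))"
    by (intro asymp_monomial_prod_0) auto
  then obtain L where "L \<ge> 0" "((\<lambda>\<epsilon>. ereal (\<Prod>m=1..a. reduced_rates q \<epsilon> (i m) (j m) /
      reduced_rates q \<epsilon> (k m) (l m))) \<longlongrightarrow> L) (at_right 0)"
    by (rule asymp_monomial_0_limit)
  then show "\<exists>L\<in>{0..\<infinity>::ereal}. ((\<lambda>\<epsilon>. ereal (\<Prod>m=1..a. reduced_rates q \<epsilon> (i m) (j m) /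
      reduced_rates q \<epsilon> (k m) (l m))) \<longlongrightarrow> L) (at_right 0)"
    by (intro bexI[of _ L]) auto
qed

end

theorem lemma2p1:
  fixes N :: nat and q :: "real \<Rightarrow> nat \<Rightarrow> nat \<Rightarrow> real"
  assumes "N \<ge> 2"
    and "completely_asymptotically_regular {1..N} q"
  shows "completely_asymptotically_regular
           (chain_classes {1..N} (skeleton {1..N} q)) (reduced_rates q)"
proof -
  interpret regular_family "{1..N}" q
    using assms(2) by unfold_locales
  show ?thesis
    using partition_on_chain_classes by (rule completely_asymptotically_regular_reduced_rates)
qed

end
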